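(* For every positive integer $r$ there exist a positive integer $k$ and a $k$-colouring of the edges of the complete graph $K_{2^{k}+1}$ whose odd girth is at least $r$.
   Context: A $k$-colouring of a graph $G$ is an assignment of one of the colours $1,\ldots,k$ to each edge of $G$ (no properness condition is imposed). The odd girth of a colouring $\mathcal{C}$ of $G$ is the length of the shortest monochromatic odd cycle in $\mathcal{C}$, i.e. the shortest cycle of odd length all of whose edges have the same colour (taken to be $\infty$ if there is none). *)

theory Defs
  imports Main "HOL-Library.Extended_Nat"
begin

text \<open>A finite simple graph is given by its set of edges, each edge being the two-element set
  of its end vertices.\<close>

definition complete_graph :: "nat \<Rightarrow> nat set set" where
  "complete_graph n = {e. e \<subseteq> {..<n} \<and> card e = 2}"

text \<open>Colours of sets that are not edges are unconstrained and never inspected below.\<close>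

definition is_colouring :: "nat \<Rightarrow> 'a set set \<Rightarrow> ('a set \<Rightarrow> nat) \<Rightarrow> bool" where
  "is_colouring k E c \<longleftrightarrow> (\<forall>e\<in>E. c e \<in> {1..k})"

text \<open>A cycle is represented by the list of its vertices, without repeating the first one at
  the end; its length (number of edges) is then the length of the list.\<close>

definition cycle_edges :: "'a list \<Rightarrow> 'a set set" where
  "cycle_edges vs = {{vs ! i, vs ! (Suc i mod length vs)} | i. i < length vs}"

definition is_cycle :: "'a set set \<Rightarrow> 'a list \<Rightarrow> bool" where
  "is_cycle E vs \<longleftrightarrow> 3 \<le> length vs \<and> distinct vs \<and> cycle_edges vs \<subseteq> E"

definition monochromatic :: "('a set \<Rightarrow> nat) \<Rightarrow> 'a set set \<Rightarrow> bool" where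
  "monochromatic c F \<longleftrightarrow> (\<exists>j. \<forall>e\<in>F. c e = j)"

text \<open>The infimum of the empty set of extended naturals is \<open>\<infinity>\<close>.\<close>

definition odd_girth :: "'a set set \<Rightarrow> ('a set \<Rightarrow> nat) \<Rightarrow> enat" where
  "odd_girth E c =
     Inf {enat (length vs) | vs. is_cycle E vs \<and> odd (length vs) \<and> monochromatic c (cycle_edges vs)}"

end

theory Submission
  imports Defs
begin

text \<open>If the vertices of the complete graph are mapped into \<open>C\<^sub>m\<^sup>k\<close>, with \<open>m = 2 q + 1\<close>, such that any
  two of them are adjacent in some coordinate, then colouring each edge by such a coordinate maps
  every colour class homomorphically to \<open>C\<^sub>m\<close>, so the odd girth is at least \<open>m\<close>.

  To obtain \<open>2 ^ k + 1\<close> such vectors, one of them is taken to be constantly \<open>0\<close>; the others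
  then avoid \<open>0\<close> in every coordinate, so they live in a power of the path \<open>1, \<dots>, 2 q\<close>, and each must
  use an end of the path in some coordinate. Such a system of \<open>2 ^ k\<close> vectors is built
  by squaring it (\<open>k \<mapsto> 2 k\<close>, \<open>q \<mapsto> q + 1\<close>): the two halves of a concatenated pair are shifted
  by \<open>0\<close> or \<open>2\<close>, and which one is decided by which end of the path the other half uses.\<close>

text \<open>The predicate \<open>t\<close> tells which end of the path a vector is guaranteed to use. The last
  condition is the invariant that makes the squaring step possible.\<close>

definition path_system :: "nat \<Rightarrow> nat \<Rightarrow> (nat \<Rightarrow> nat \<Rightarrow> int) \<Rightarrow> (nat \<Rightarrow> bool) \<Rightarrow> bool" where
  "path_system q k p t \<longleftrightarrow>
     (\<forall>v<2^k. \<forall>i<k. 1 \<le> p v i \<and> p v i \<le> 2 * int q) \<and>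
     (\<forall>v<2^k. \<exists>i<k. p v i = (if t v then 2 * int q else 1)) \<and>
     (\<forall>u<2^k. \<forall>v<2^k. u \<noteq> v \<longrightarrow> (\<exists>i<k. \<bar>p u i - p v i\<bar> = 1)) \<and>
     (\<forall>u<2^k. \<forall>v<2^k. t u \<longrightarrow> \<not> t v \<longrightarrow> (\<exists>i<k. \<bar>p u i - (p v i + 2)\<bar> = 1))"

text \<open>The path is 1, 2 and each vertex is a vector; the end 2 has type \<open>t\<close>, and 2
  is next to 1 + 2.\<close>

lemma path_system_base: "path_system 1 1 (\<lambda>v i. int v + 1) (\<lambda>v. v = 1)"
  by (auto simp: path_system_def less_Suc_eq numeral_2_eq_2)

lemma path_system_square:
  assumes "path_system q k p t"
  shows "\<exists>p' t'. path_system (Suc q) (2 * k) p' t'"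
proof -
  define N :: nat where "N = 2 ^ k"
  have N: "2 ^ (2 * k) = N * N" by (simp add: N_def mult_2 power_add)
  have "N > 0" by (simp add: N_def)
  have range: "1 \<le> p v i" "p v i \<le> 2 * int q" if "v < N" "i < k" for v i
    using assms that by (auto simp: path_system_def N_def)
  have ends: "\<exists>i<k. p v i = (if t v then 2 * int q else 1)" if "v < N" for v
    using assms that by (simp add: path_system_def N_def)
  have adj: "\<exists>i<k. \<bar>p u i - p v i\<bar> = 1" if "u < N" "v < N" "u \<noteq> v" for u v
    using assms that by (simp add: path_system_def N_def)
  have shifted: "\<exists>i<k. \<bar>p u i - (p v i + 2)\<bar> = 1" if "u < N" "v < N" "t u" "\<not> t v" for u v
    using assms that by (simp add: path_system_def N_def)
  define s where "s b = (if b then 2 else 0 :: int)" for b :: bool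
  \<comment> \<open>Read \<open>v\<close> as the pair (a, b) of \<open>v div N\<close> and
    \<open>v mod N\<close>. The negation makes the halves complementary: the new end is reached in
    the first half if a and b have equal types, in the second otherwise; for two pairs that differ
    in both types, the shifts match \<open>shifted\<close> in exactly one half.\<close>
  define p' where "p' v i = (if i < k then p (v div N) i + s (t (v mod N))
     else p (v mod N) (i - k) + s (\<not> t (v div N)))" for v i
  define t' where "t' v = t (v mod N)" for v
  \<comment> \<open>A general \<open>P\<close> lets ends, adjacency and shifted adjacency all be
    lifted from one half.\<close>
  have lo: "\<exists>i<2*k. P (p' u i) (p' v i)"
    if "\<exists>i<k. P (p (u div N) i + s (t (u mod N))) (p (v div N) i + s (t (v mod N)))" for P u v
  proof -
    from that obtain i where "i < k" "P (p' u i) (p' v i)" by (auto simp: p'_def)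
    then show ?thesis by (intro exI[of _ i]) auto
  qed
  have hi: "\<exists>i<2*k. P (p' u i) (p' v i)"
    if "\<exists>i<k. P (p (u mod N) i + s (\<not> t (u div N))) (p (v mod N) i + s (\<not> t (v div N)))" for P u v
  proof -
    from that obtain i where "i < k" "P (p' u (i + k)) (p' v (i + k))" by (auto simp: p'_def)
    then show ?thesis by (intro exI[of _ "i + k"]) auto
  qed
  have dm: "v div N < N" "v mod N < N" if "v < N * N" for v
    using that \<open>N > 0\<close> by (auto simp: less_mult_imp_div_less)
  have range': "1 \<le> p' v i \<and> p' v i \<le> 2 * int (Suc q)" if "v < N * N" "i < 2 * k" for v i
  proof (cases "i < k")
    case True
    then show ?thesis using range[of "v div N" i] dm[OF that(1)] by (simp add: p'_def s_def)
  next
    case False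
    then have "i - k < k" using that(2) by simp
    with False show ?thesis
      using range[of "v mod N" "i - k"] dm[OF that(1)] by (simp add: p'_def s_def)
  qed
  have ends': "\<exists>i<2*k. p' v i = (if t' v then 2 * int (Suc q) else 1)" if v: "v < N * N" for v
  proof (cases "t (v div N) = t (v mod N)")
    case True
    then show ?thesis
      using ends[OF dm(1)[OF v]]
      by (intro lo[where P = "\<lambda>x _. x = (if t' v then 2 * int (Suc q) else 1)" and v = v])
        (auto simp: t'_def s_def)
  next
    case False
    then show ?thesis
      using ends[OF dm(2)[OF v]]
      by (intro hi[where P = "\<lambda>x _. x = (if t' v then 2 * int (Suc q) else 1)" and v = v])
        (auto simp: t'_def s_def)
  qed
  have adj': "\<exists>i<2*k. \<bar>p' u i - p' v i\<bar> = 1" if u: "u < N * N" and v: "v < N * N" and "u \<noteq> v" for u v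
  proof -
    have *: "u div N \<noteq> v div N \<or> u mod N \<noteq> v mod N"
      using \<open>u \<noteq> v\<close> by (metis div_mult_mod_eq)
    note du = dm[OF u] and dv = dm[OF v]
    consider (fst) "u div N \<noteq> v div N" "t (u mod N) = t (v mod N)"
      | (snd) "u mod N \<noteq> v mod N" "t (u div N) = t (v div N)"
      | (both) "t (u div N) \<noteq> t (v div N)" "t (u mod N) \<noteq> t (v mod N)"
      using * by (cases "u div N = v div N"; cases "u mod N = v mod N") auto
    then show ?thesis
    proof cases
      case fst
      then show ?thesis
        using adj[OF du(1) dv(1)] by (intro lo[of "\<lambda>x y. \<bar>x - y\<bar> = 1"]) simp
    next
      case snd
      then show ?thesis
        using adj[OF du(2) dv(2)] by (intro hi[of "\<lambda>x y. \<bar>x - y\<bar> = 1"]) simp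
    next
      case both
      consider "t (u div N)" "\<not> t (v div N)" "t (u mod N)" "\<not> t (v mod N)"
        | "t (u div N)" "\<not> t (v div N)" "\<not> t (u mod N)" "t (v mod N)"
        | "\<not> t (u div N)" "t (v div N)" "t (u mod N)" "\<not> t (v mod N)"
        | "\<not> t (u div N)" "t (v div N)" "\<not> t (u mod N)" "t (v mod N)"
        using both by blast
      then show ?thesis
      proof cases
        case 1
        then show ?thesis using shifted[OF du(2) dv(2)]
          by (intro hi[of "\<lambda>x y. \<bar>x - y\<bar> = 1"]) (simp add: s_def)
      next
        case 2
        then show ?thesis using shifted[OF du(1) dv(1)]
          by (intro lo[of "\<lambda>x y. \<bar>x - y\<bar> = 1"]) (simp add: s_def)
      next
        case 3
        then show ?thesis using shifted[OF dv(1) du(1)]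
          by (intro lo[of "\<lambda>x y. \<bar>x - y\<bar> = 1"]) (simp add: s_def abs_minus_commute)
      next
        case 4
        then show ?thesis using shifted[OF dv(2) du(2)]
          by (intro hi[of "\<lambda>x y. \<bar>x - y\<bar> = 1"]) (simp add: s_def abs_minus_commute)
      qed
    qed
  qed
  have shifted': "\<exists>i<2*k. \<bar>p' u i - (p' v i + 2)\<bar> = 1"
    if u: "u < N * N" and v: "v < N * N" and t: "t' u" "\<not> t' v" for u v
  proof (cases "u div N = v div N")
    case True
    then show ?thesis
      using shifted[OF dm(2)[OF u] dm(2)[OF v]] t
      by (intro hi[of "\<lambda>x y. \<bar>x - (y + 2)\<bar> = 1"]) (simp add: t'_def algebra_simps)
  next
    case False
    \<comment> \<open>The first half of \<open>u\<close> is shifted by 2 and that of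
      \<open>v\<close> by 0, which cancels the 2 and leaves plain adjacency.\<close>
    then show ?thesis
      using adj[OF dm(1)[OF u] dm(1)[OF v]] t
      by (intro lo[of "\<lambda>x y. \<bar>x - (y + 2)\<bar> = 1"]) (simp add: t'_def s_def)
  qed
  have "path_system (Suc q) (2 * k) p' t'"
    unfolding path_system_def N using range' ends' adj' shifted' by blast
  then show ?thesis by blast
qed

lemma path_system_exists: "\<exists>p t. path_system (Suc n) (2 ^ n) p t"
proof (induction n)
  case 0
  then show ?case using path_system_base by auto
next
  case (Suc n)
  then show ?case using path_system_square by auto
qed

text \<open>For \<open>x, y \<in> {0..2 q}\<close>, adjacency in the cycle of length \<open>2 q + 1\<close> is
  \<open>\<bar>x - y\<bar> \<in> {1, 2 q}\<close>.\<close>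

lemma clique_exists:
  "\<exists>p :: nat \<Rightarrow> nat \<Rightarrow> int. \<forall>u\<le>2^2^n. \<forall>v\<le>2^2^n. u \<noteq> v \<longrightarrow>
     (\<exists>i<2^n. \<bar>p u i - p v i\<bar> \<in> {1, 2 * int (Suc n)})"
proof -
  obtain p t where p: "path_system (Suc n) (2 ^ n) p t"
    using path_system_exists by blast
  define p' where "p' v i = (if v < 2^2^n then p v i else 0)" for v i
  \<comment> \<open>These are differences from the zero vector at index \<open>2^2^n\<close>: the
    path ends are the neighbours of 0 on the cycle.\<close>
  have zero: "\<exists>i<2^n. \<bar>p' v i\<bar> \<in> {1, 2 * int (Suc n)}" if "v < 2^2^n" for v
  proof -
    have "\<exists>i<2^n. p v i = (if t v then 2 * int (Suc n) else 1)"
      using p that by (simp add: path_system_def)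
    then obtain i where "i < 2^n" "p v i = (if t v then 2 * int (Suc n) else 1)"
      by blast
    with that show ?thesis by (intro exI[of _ i]) (auto simp: p'_def)
  qed
  have "\<exists>i<2^n. \<bar>p' u i - p' v i\<bar> \<in> {1, 2 * int (Suc n)}"
    if uv: "u \<le> 2^2^n" "v \<le> 2^2^n" "u \<noteq> v" for u v
  proof -
    consider "u < 2^2^n" "v < 2^2^n" | "u < 2^2^n" "v = 2^2^n" | "u = 2^2^n" "v < 2^2^n"
      using uv by linarith
    then show ?thesis
    proof cases
      case 1
      then obtain i where "i < 2^n" "\<bar>p u i - p v i\<bar> = 1"
        using p \<open>u \<noteq> v\<close> unfolding path_system_def by blast
      with 1 show ?thesis by (intro exI[of _ i]) (auto simp: p'_def)
    next
      case 2
      then have "p' v i = 0" for i by (simp add: p'_def)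
      with zero[of u] 2 show ?thesis by simp
    next
      case 3
      then have "p' u i = 0" for i by (simp add: p'_def)
      with zero[of v] 3 show ?thesis by simp
    qed
  qed
  then show ?thesis by blast
qed

text \<open>All terms but the last telescope; the last wraps around to \<open>x 0\<close> and
  cancels the rest.\<close>

lemma sum_cyclic_diff:
  fixes x :: "nat \<Rightarrow> 'a::ab_group_add"
  shows "(\<Sum>i<L. x (Suc i mod L) - x i) = 0"
proof (cases L)
  case (Suc n)
  have "(\<Sum>i<n. x (Suc i mod L) - x i) = (\<Sum>i<n. x (Suc i) - x i)"
    by (rule sum.cong) (auto simp: Suc)
  also have "\<dots> = x n - x 0" by (rule sum_lessThan_telescope)
  finally show ?thesis by (simp add: Suc)
qed simp

text \<open>Lift the steps of the walk to \<open>\<plusminus>1\<close>: their sum is an odd multiple of \<open>2 q + 1\<close>.\<close>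

lemma odd_closed_walk_length:
  fixes x :: "nat \<Rightarrow> int"
  assumes "odd L"
    and step: "\<And>i. i < L \<Longrightarrow> \<bar>x i - x (Suc i mod L)\<bar> \<in> {1, 2 * int q}"
  shows "2 * q + 1 \<le> L"
proof -
  let ?m = "2 * int q + 1"
  have "\<forall>i\<in>{..<L}. \<exists>e. \<bar>e\<bar> = 1 \<and> ?m dvd (x (Suc i mod L) - x i) - e"
  proof
    fix i assume "i \<in> {..<L}"
    then have "\<bar>x i - x (Suc i mod L)\<bar> \<in> {1, 2 * int q}" using step by simp
    \<comment> \<open>Modulo \<open>?m\<close>, the wrap-around steps 2 q and -2 q are -1 and
      1.\<close>
    then consider "\<bar>x (Suc i mod L) - x i\<bar> = 1" | "x (Suc i mod L) - x i = 2 * int q"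
      | "x (Suc i mod L) - x i = - (2 * int q)"
      by (auto simp: abs_if split: if_splits)
    then show "\<exists>e. \<bar>e\<bar> = 1 \<and> ?m dvd (x (Suc i mod L) - x i) - e"
    proof cases
      case 1
      then show ?thesis by (intro exI[of _ "x (Suc i mod L) - x i"]) simp
    next
      case 2
      then show ?thesis by (intro exI[of _ "-1"]) simp
    next
      case 3
      then have "(x (Suc i mod L) - x i) - 1 = - ?m" by simp
      then show ?thesis by (intro exI[of _ 1]) (metis abs_one dvd_minus_iff dvd_refl)
    qed
  qed
  then obtain e where "\<forall>i\<in>{..<L}. \<bar>e i\<bar> = 1 \<and> ?m dvd (x (Suc i mod L) - x i) - e i"
    by (rule bchoice[THEN exE])
  then have e: "\<And>i. i < L \<Longrightarrow> \<bar>e i\<bar> = 1"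
    and dvd: "\<And>i. i < L \<Longrightarrow> ?m dvd (x (Suc i mod L) - x i) - e i"
    by simp_all
  have "?m dvd (\<Sum>i<L. (x (Suc i mod L) - x i) - e i)"
    using dvd by (intro dvd_sum) simp
  then have "?m dvd (\<Sum>i<L. e i)"
    by (simp add: sum_subtractf[of "\<lambda>i. x (Suc i mod L) - x i"] sum_cyclic_diff)
  \<comment> \<open>Oddness makes this multiple of \<open>?m\<close> nonzero, hence at least
    \<open>?m\<close> in absolute value.\<close>
  moreover have "odd (\<Sum>i<L. e i)"
  proof -
    have "odd (e i)" if "i < L" for i
      using e[OF that] by (metis dvd_abs_iff odd_one)
    then have "{i \<in> {..<L}. odd (e i)} = {..<L}" by auto
    with \<open>odd L\<close> show ?thesis by (simp add: even_sum_iff)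
  qed
  ultimately have "?m \<le> \<bar>\<Sum>i<L. e i\<bar>"
    by (intro zdvd_imp_le) (auto simp: zero_less_abs_iff)
  also have "\<dots> \<le> (\<Sum>i<L. \<bar>e i\<bar>)" by (rule sum_abs)
  also have "\<dots> = int L" using e by simp
  finally show ?thesis by linarith
qed

theorem theorem2:
  fixes r :: nat
  assumes "0 < r"
  shows "\<exists>k::nat. 0 < k \<and>
           (\<exists>c. is_colouring k (complete_graph (2 ^ k + 1)) c \<and>
                enat r \<le> odd_girth (complete_graph (2 ^ k + 1)) c)"
proof -
  \<comment> \<open>This choice gives the cycle of length 2 r + 3.\<close>
  define k :: nat where "k = 2 ^ r"
  define adj where "adj a b \<longleftrightarrow> \<bar>a - b\<bar> \<in> {1, 2 * int (Suc r)}" for a b :: int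
  obtain p :: "nat \<Rightarrow> nat \<Rightarrow> int"
    where p: "\<And>u v. u \<le> 2^k \<Longrightarrow> v \<le> 2^k \<Longrightarrow> u \<noteq> v \<Longrightarrow> \<exists>i<k. adj (p u i) (p v i)"
    using clique_exists[of r] unfolding k_def adj_def by blast
  have adj_sym: "adj a b \<longleftrightarrow> adj b a" for a b
    by (simp add: adj_def abs_minus_commute)
  define G where "G = complete_graph (2 ^ k + 1)"
  have "\<forall>e\<in>G. \<exists>i. i < k \<and> (\<forall>u\<in>e. \<forall>v\<in>e. u \<noteq> v \<longrightarrow> adj (p u i) (p v i))"
  proof
    fix e assume "e \<in> G"
    then obtain u v where e: "e = {u, v}" "u \<noteq> v" "u \<le> 2^k" "v \<le> 2^k"
      by (auto simp: G_def complete_graph_def card_2_iff less_Suc_eq_le)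
    then obtain i where "i < k" "adj (p u i) (p v i)" using p by blast
    with e show "\<exists>i. i < k \<and> (\<forall>u\<in>e. \<forall>v\<in>e. u \<noteq> v \<longrightarrow> adj (p u i) (p v i))"
      using adj_sym by (intro exI[of _ i]) auto
  qed
  then obtain f where "\<forall>e\<in>G. f e < k \<and> (\<forall>u\<in>e. \<forall>v\<in>e. u \<noteq> v \<longrightarrow> adj (p u (f e)) (p v (f e)))"
    by (rule bchoice[THEN exE])
  then have f: "\<And>e. e \<in> G \<Longrightarrow> f e < k"
    "\<And>e u v. e \<in> G \<Longrightarrow> u \<in> e \<Longrightarrow> v \<in> e \<Longrightarrow> u \<noteq> v \<Longrightarrow> adj (p u (f e)) (p v (f e))"
    by blast+
  \<comment> \<open>Coordinates start at 0 and colours at 1, so colour \<open>j\<close> below stands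
    for coordinate \<open>j - 1\<close>.\<close>
  define c where "c = Suc \<circ> f"
  have "is_colouring k G c"
    using f(1) by (force simp: is_colouring_def c_def)
  moreover have "enat r \<le> odd_girth G c"
    unfolding odd_girth_def
  proof (rule Inf_greatest, clarsimp)
    fix vs assume cyc: "is_cycle G vs" and odd: "odd (length vs)"
      and mono: "monochromatic c (cycle_edges vs)"
    let ?L = "length vs"
    obtain j where j: "\<And>e. e \<in> cycle_edges vs \<Longrightarrow> c e = j"
      using mono by (auto simp: monochromatic_def)
    have "adj (p (vs ! i) (j - 1)) (p (vs ! (Suc i mod ?L)) (j - 1))" if "i < ?L" for i
    proof -
      let ?e = "{vs ! i, vs ! (Suc i mod ?L)}"
      have "?e \<in> cycle_edges vs" using that by (auto simp: cycle_edges_def)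
      moreover from this have e: "?e \<in> G" using cyc by (auto simp: is_cycle_def)
      \<comment> \<open>Edges of \<open>G\<close> have two elements, so consecutive vertices
        differ.\<close>
      moreover have "vs ! i \<noteq> vs ! (Suc i mod ?L)"
        using e by (auto simp: G_def complete_graph_def card_2_iff doubleton_eq_iff)
      ultimately show ?thesis using f(2)[of ?e] j[of ?e] by (auto simp: c_def)
    qed
    then have "2 * Suc r + 1 \<le> ?L"
      using odd by (intro odd_closed_walk_length[where x = "\<lambda>i. p (vs ! i) (j - 1)"])
        (simp_all add: adj_def)
    then show "r \<le> ?L" by simp
  qed
  ultimately show ?thesis
    unfolding G_def by (intro exI[of _ k]) (auto simp: k_def)
qed

end
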